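(* Let $p\in\{0,1\}$. As formal Laurent series in $x$ with coefficients in $\mathbb{Z}[y]$, $$\sum_{n,m}w_{[p]}(n,m)x^ny^m=\frac{1-x^2}{x\Big(1-x-x^2\big(1+y^{[\![p=1]\!]}\big)+x^3\big(1-y^{[\![p=0]\!]}\big)\Big)}.$$
   Context: $[\![P]\!]$ is the Iverson bracket ($1$ if $P$ is true, $0$ otherwise). An $n$-string is a binary string of length $n$. A nonnull run of ones is a maximal block of consecutive ones of length at least $1$; it is a $p$-parity run if its length is congruent to $p$ modulo $2$. For $n\ge 0$, $w_{[p]}(n,m)$ is the number of $n$-strings containing exactly $m$ nonnull $p$-parity runs of ones (runs of the opposite parity are unrestricted). By convention $w_{[p]}(-1,m)=1$ if $m=0$ and $0$ otherwise, and $w_{[p]}(n,m)=0$ if $n<-1$ or $m<0$. The sum is over all integers $n,m$. *)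

theory Defs
  imports "HOL-Computational_Algebra.Computational_Algebra" "HOL-Number_Theory.Cong"
begin

text \<open>
  Binary strings are lists of booleans, with \<open>True\<close> for the letter one. A run of ones is
  encoded by the pair \<open>(i, j)\<close> where \<open>i\<close> is its first position and \<open>j\<close> the first position
  after it, so that its length is \<open>j - i\<close>; it is nonnull since \<open>i < j\<close>.
\<close>

definition one_runs :: "bool list \<Rightarrow> (nat \<times> nat) set" where
  "one_runs s = {(i, j). i < j \<and> j \<le> length s \<and> (\<forall>k\<in>{i..<j}. s ! k) \<and>
     (i = 0 \<or> \<not> s ! (i - 1)) \<and> (j = length s \<or> \<not> s ! j)}"

definition parity_runs :: "nat \<Rightarrow> bool list \<Rightarrow> (nat \<times> nat) set" where
  "parity_runs p s = {(i, j) \<in> one_runs s. [j - i = p] (mod 2)}"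

definition w :: "nat \<Rightarrow> int \<Rightarrow> int \<Rightarrow> nat" where
  "w p n m =
     (if n < -1 \<or> m < 0 then 0
      else if n = -1 then (if m = 0 then 1 else 0)
      else card {s. length s = nat n \<and> int (card (parity_runs p s)) = m})"

text \<open>
  The formal sum of \<open>a n m x\<^sup>n y\<^sup>m\<close> over all integers \<open>n\<close>, \<open>m\<close>, as a Laurent series in
  \<open>x\<close> over \<open>\<int>[y]\<close>. It is meaningful if \<open>a n m\<close> vanishes for negative \<open>m\<close>, for all \<open>n\<close>
  below some bound, and, with \<open>n\<close> fixed, for all but finitely many \<open>m\<close>.
\<close>

definition formal_sum :: "(int \<Rightarrow> int \<Rightarrow> int) \<Rightarrow> int poly fls" where
  "formal_sum a = Abs_fls (\<lambda>n. \<Sum>m | a n m \<noteq> 0. monom (a n m) (nat m))"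

abbreviation fls_Y :: "int poly fls" where
  "fls_Y \<equiv> fls_const (monom 1 1)"

text \<open>
  The library's division of Laurent series requires an \<open>inverse\<close> operation on the coefficients,
  which \<open>\<int>[y]\<close> lacks. The following is the quotient by a series whose lowest nonzero
  coefficient is \<open>1\<close>, and thus a unit.
\<close>

definition fls_quotient :: "'a::comm_ring_1 fls \<Rightarrow> 'a fls \<Rightarrow> 'a fls" where
  "fls_quotient f g = f * fls_right_inverse g 1"

lemma fls_quotient_iff:
  fixes f g h :: "'a::comm_ring_1 fls"
  assumes "fls_nth g (fls_subdegree g) = 1"
  shows "h = fls_quotient f g \<longleftrightarrow> h * g = f"
proof -
  have inv: "g * fls_right_inverse g 1 = 1"
    by (rule fls_right_inverse) (simp add: assms)
  show ?thesis
  proof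
    assume "h = fls_quotient f g"
    then have "h * g = f * (g * fls_right_inverse g 1)"
      unfolding fls_quotient_def by (simp only: mult_ac)
    then show "h * g = f" by (simp only: inv mult_1_right)
  next
    assume "h * g = f"
    then have "fls_quotient f g = h * (g * fls_right_inverse g 1)"
      unfolding fls_quotient_def mult.assoc [symmetric] by (simp only:)
    then show "h = fls_quotient f g" by (simp only: inv mult_1_right)
  qed
qed

lemma lowest_coeff_denominator:
  fixes k l :: nat
  defines "D \<equiv> fls_X * (1 - fls_X - fls_X^2 * (1 + fls_Y ^ k) + fls_X^3 * (1 - fls_Y ^ l))"
  shows "fls_nth D (fls_subdegree D) = 1"
proof -
  define y :: "int poly fps" where "y = fps_const (monom 1 1)"
  define E where "E = 1 - fps_X - fps_X^2 * (1 + y ^ k) + fps_X^3 * (1 - y ^ l)"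
  have E0: "fps_nth E 0 = 1"
    by (simp add: E_def)
  have "fps_to_fls y = fls_Y"
    by (simp only: y_def fps_const_to_fls)
  then have D: "D = fps_to_fls (fps_X * E)"
    unfolding D_def E_def by (simp add: fls_times_fps_to_fls fps_to_fls_power)
  have 1: "fls_nth D 1 = 1"
    using E0 by (simp add: D del: fps_X_to_fls)
  have "fls_nth D i = 0" if "i < 1" for i
    using that by (auto simp: D)
  with 1 have "fls_subdegree D = 1"
    by (intro fls_subdegree_eqI) auto
  with 1 show ?thesis by simp
qed

lemma finite_w_support: "finite {m. w p n m \<noteq> 0}"
proof -
  have "{m. w p n m \<noteq> 0} \<subseteq>
      insert 0 ((\<lambda>s. int (card (parity_runs p s))) ` {s. set s \<subseteq> UNIV \<and> length s = nat n})"
  proof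
    fix m assume "m \<in> {m. w p n m \<noteq> 0}"
    then have "m = 0 \<or> {s. length s = nat n \<and> int (card (parity_runs p s)) = m} \<noteq> {}"
      unfolding w_def by (auto split: if_splits simp del: Collect_empty_eq)
    then show "m \<in> insert 0
        ((\<lambda>s. int (card (parity_runs p s))) ` {s. set s \<subseteq> UNIV \<and> length s = nat n})"
      by auto
  qed
  then show ?thesis
    by (rule finite_subset) (intro finite.insertI finite_imageI finite_lists_length_eq finite_UNIV)
qed

lemma coeff_formal_sum_w:
  "poly.coeff (fls_nth (formal_sum (\<lambda>n m. int (w p n m))) n) k = int (w p n (int k))"
proof -
  have "fls_nth (formal_sum (\<lambda>n m. int (w p n m))) n
      = (\<Sum>m | int (w p n m) \<noteq> 0. monom (int (w p n m)) (nat m))"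
    unfolding formal_sum_def
    by (rule nth_Abs_fls_lower_bound[of "-1"]) (simp add: w_def)
  also have "poly.coeff \<dots> k = (\<Sum>m | w p n m \<noteq> 0. if nat m = k then int (w p n m) else 0)"
    by (simp add: coeff_sum)
  also have "\<dots> = (\<Sum>m | w p n m \<noteq> 0. if m = int k then int (w p n m) else 0)"
    by (rule sum.cong) (auto simp: w_def split: if_splits)
  also have "\<dots> = int (w p n (int k))"
    using finite_w_support[of p n] by simp
  finally show ?thesis .
qed

end

theory Submission
  imports Defs
begin

text \<open>
  Weight a string with \<open>m\<close> nonnull \<open>p\<close>-parity runs of ones by \<open>y\<^sup>m\<close>. A zero ends every run, so the
  weight of \<open>u 0 v\<close> is the product of the weights of \<open>u\<close> and \<open>v\<close>. Hence, if a zero is appended to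
  every string, the result is an arbitrary nonempty sequence of blocks \<open>1\<^sup>k 0\<close>, and weights multiply
  along it. With \<open>t\<^sub>k\<close> the weight of \<open>1\<^sup>k\<close> and \<open>A = \<Sum>\<^sub>k t\<^sub>k x\<^sup>k\<close>, one block contributes \<open>x A\<close>. The
  convention at \<open>n = -1\<close> accounts for the empty sequence of blocks, so the sum in question,
  multiplied by \<open>x\<close>, is a series \<open>G\<close> with \<open>G = 1 + x A G\<close> (\<open>shifted_gf_eq\<close>).

  For \<open>k \<ge> 1\<close> the weight \<open>t\<^sub>k\<close> depends only on the parity of \<open>k\<close>, so that \<open>(1 - x\<^sup>2) A\<close> is the quadratic
  polynomial \<open>1 + t\<^sub>1 x + (t\<^sub>2 - 1) x\<^sup>2\<close> (\<open>ones_gf_times\<close>); the term \<open>-1\<close> is there because the empty run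
  has weight \<open>1\<close> for both \<open>p\<close>. Multiplying the equation for \<open>G\<close> by \<open>1 - x\<^sup>2\<close> and inserting
  \<open>t\<^sub>1\<close> and \<open>t\<^sub>2\<close>, which are \<open>y\<close> and \<open>1\<close> if \<open>p = 1\<close> and \<open>1\<close> and \<open>y\<close> if \<open>p = 0\<close>, gives the quotient.
\<close>

section \<open>Runs and weights across a zero\<close>

text \<open>
  No run contains the position of the zero, so each run lies on one side of it. The zero delimits
  a run that touches it just as the end of \<open>u\<close> or the beginning of \<open>v\<close> does.
\<close>

lemma one_runs_append_zero:
  "one_runs (u @ False # v) =
     one_runs u \<union> (\<lambda>(i, j). (i + Suc (length u), j + Suc (length u))) ` one_runs v"
proof (intro set_eqI iffI)
  let ?n = "Suc (length u)"
  let ?s = "u @ False # v"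
  have right: "?s ! (k + ?n) = v ! k" for k
    by (simp add: nth_append)
  have left: "?s ! k = u ! k" if "k < length u" for k
    using that by (simp add: nth_append)
  have mid: "\<not> ?s ! length u"
    by simp
  {
    fix r assume r: "r \<in> one_runs ?s"
    obtain i j where ij: "r = (i, j)" by fastforce
    have h: "i < j" "j \<le> length ?s" "\<And>k. i \<le> k \<Longrightarrow> k < j \<Longrightarrow> ?s ! k"
      "i = 0 \<or> \<not> ?s ! (i - 1)" "j = length ?s \<or> \<not> ?s ! j"
      using r unfolding ij one_runs_def by auto
    show "r \<in> one_runs u \<union> (\<lambda>(i, j). (i + ?n, j + ?n)) ` one_runs v"
    proof (cases "i \<le> length u")
      case True
      have j: "j \<le> length u"
        using h(3)[of "length u"] mid True by fastforce
      have "(i, j) \<in> one_runs u"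
        unfolding one_runs_def using h j left by auto
      then show ?thesis using ij by simp
    next
      case False
      define i' j' where "i' = i - ?n" and "j' = j - ?n"
      have e: "i = i' + ?n" "j = j' + ?n"
        using False h(1) by (auto simp: i'_def j'_def)
      have 1: "v ! k" if "i' \<le> k" "k < j'" for k
        using h(3)[of "k + ?n"] that right[of k] by (simp add: e)
      have 2: "i' = 0 \<or> \<not> v ! (i' - 1)"
        using h(4) right[of "i' - 1"] by (cases i') (auto simp: e)
      have 3: "j' = length v \<or> \<not> v ! j'"
        using h(5) right[of j'] by (auto simp: e)
      have "(i', j') \<in> one_runs v"
        unfolding one_runs_def using h(1,2) 1 2 3 by (auto simp: e)
      then show ?thesis using ij e by force
    qed
  }
  {
    fix r assume "r \<in> one_runs u \<union> (\<lambda>(i, j). (i + ?n, j + ?n)) ` one_runs v"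
    then consider (l) i j where "r = (i, j)" "(i, j) \<in> one_runs u"
      | (r) i j where "r = (i + ?n, j + ?n)" "(i, j) \<in> one_runs v"
      by (cases r) auto
    then show "r \<in> one_runs ?s"
    proof cases
      case l
      have h: "i < j" "j \<le> length u" "\<forall>k\<in>{i..<j}. u ! k"
        "i = 0 \<or> \<not> u ! (i - 1)" "j = length u \<or> \<not> u ! j"
        using l(2) unfolding one_runs_def by auto
      have "i = 0 \<or> \<not> ?s ! (i - 1)"
        using h left[of "i - 1"] by auto
      moreover have "\<not> ?s ! j"
        using h left[of j] mid by (cases "j = length u") auto
      ultimately show ?thesis
        unfolding l(1) one_runs_def using h left by auto
    next
      case r
      have h: "i < j" "j \<le> length v" "\<And>k. i \<le> k \<Longrightarrow> k < j \<Longrightarrow> v ! k"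
        "i = 0 \<or> \<not> v ! (i - 1)" "j = length v \<or> \<not> v ! j"
        using r(2) unfolding one_runs_def by auto
      have 1: "?s ! k" if "i + ?n \<le> k" "k < j + ?n" for k
        using h(3)[of "k - ?n"] that right[of "k - ?n"] by auto
      have 2: "\<not> ?s ! (i + ?n - 1)"
        using h(4) right[of "i - 1"] mid by (cases i) auto
      have 3: "j + ?n = length ?s \<or> \<not> ?s ! (j + ?n)"
        using h(5) right[of j] by auto
      show ?thesis
        unfolding r(1) one_runs_def using h(1,2) 1 2 3 by auto
    qed
  }
qed

lemma one_runs_replicate_True:
  "one_runs (replicate k True) = (if k = 0 then {} else {(0, k)})"
proof -
  have "i = 0 \<and> j = k" if "(i, j) \<in> one_runs (replicate k True)" for i j
  proof -
    have ij: "i < j" "j \<le> k" "i = 0 \<or> \<not> replicate k True ! (i - 1)"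
      "j = k \<or> \<not> replicate k True ! j"
      using that by (simp_all add: one_runs_def)
    have "\<not> j < k"
    proof
      assume "j < k"
      with ij(4) show False by simp
    qed
    moreover have "replicate k True ! (i - 1)" using ij(1,2) by simp
    ultimately show ?thesis using ij(2,3) by simp
  qed
  moreover have "(0, k) \<in> one_runs (replicate k True) \<longleftrightarrow> k \<noteq> 0"
    by (auto simp: one_runs_def)
  ultimately show ?thesis by (cases "k = 0") auto
qed

lemma finite_parity_runs: "finite (parity_runs p s)"
  by (rule finite_subset[of _ "{..length s} \<times> {..length s}"])
     (auto simp: parity_runs_def one_runs_def)

definition run_weight :: "nat \<Rightarrow> bool list \<Rightarrow> int poly" where
  "run_weight p s = monom 1 (card (parity_runs p s))"

lemma run_weight_append_zero:
  "run_weight p (u @ False # v) = run_weight p u * run_weight p v"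
proof -
  let ?f = "\<lambda>(i, j). (i + Suc (length u), j + Suc (length u))"
  have "parity_runs p (u @ False # v) = parity_runs p u \<union> ?f ` parity_runs p v"
    by (auto simp: parity_runs_def one_runs_append_zero)
  moreover have "parity_runs p u \<inter> ?f ` parity_runs p v = {}"
    by (auto simp: parity_runs_def one_runs_def)
  moreover have "inj_on ?f (parity_runs p v)"
    by (auto simp: inj_on_def)
  ultimately have "card (parity_runs p (u @ False # v)) =
      card (parity_runs p u) + card (parity_runs p v)"
    by (simp add: card_Un_disjoint finite_parity_runs card_image)
  then show ?thesis
    by (simp add: run_weight_def mult_monom)
qed

lemma run_weight_replicate_True:
  "run_weight p (replicate k True) = monom 1 (of_bool (0 < k \<and> [k = p] (mod 2)))"
proof -
  have "parity_runs p (replicate k True) = (if 0 < k \<and> [k = p] (mod 2) then {(0, k)} else {})"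
    by (auto simp: parity_runs_def one_runs_replicate_True split: if_splits)
  then show ?thesis
    by (simp add: run_weight_def)
qed

section \<open>Decomposition at the first zero\<close>

definition strings_weight :: "nat \<Rightarrow> nat \<Rightarrow> int poly" where
  "strings_weight p n = (\<Sum>s | length s = n. run_weight p s)"

lemma finite_strings: "finite {s :: bool list. length s = n}"
  using finite_lists_length_eq[of "UNIV :: bool set" n] by simp

lemma coeff_strings_weight: "poly.coeff (strings_weight p n) k = int (w p (int n) (int k))"
proof -
  have "poly.coeff (strings_weight p n) k =
      (\<Sum>s | length s = n. if card (parity_runs p s) = k then 1 else 0)"
    by (simp add: strings_weight_def run_weight_def coeff_sum)
  also have "\<dots> = int (card {s. length s = n \<and> card (parity_runs p s) = k})"
    using finite_strings[of n] by (simp add: sum.If_cases Collect_conj_eq)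
  finally show ?thesis
    by (simp add: w_def)
qed

text \<open>Every string is either \<open>1\<^sup>n\<close> or has a unique first zero.\<close>

lemma strings_first_zero:
  "{s. length s = n} = insert (replicate n True)
     (\<Union>k<n. (\<lambda>v. replicate k True @ False # v) ` {v. length v = n - Suc k})"
  (is "?L = ?R")
proof (intro set_eqI iffI)
  fix s assume "s \<in> ?L"
  then have len: "length s = n" by simp
  show "s \<in> ?R"
  proof (cases "False \<in> set s")
    case True
    then obtain u v where s: "s = u @ False # v" and u: "False \<notin> set u"
      by (meson split_list_first)
    have "u = replicate (length u) True"
      using u by (intro replicate_eqI) (simp, metis (full_types))
    then have "s = replicate (length u) True @ False # v"
      using s by simp
    moreover have "length u < n" "length v = n - Suc (length u)"
      using s len by auto
    ultimately show ?thesis by blast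
  next
    case False
    then have "s = replicate n True"
      using len by (intro replicate_eqI) (simp, metis (full_types))
    then show ?thesis by simp
  qed
qed auto

lemma first_zero_unique:
  assumes "replicate k True @ False # u = replicate l True @ False # v"
  shows "k = l"
  using arg_cong[OF assms, of "\<lambda>s. length (takeWhile id s)"]
  by (simp add: takeWhile_append)

lemma strings_weight_rec:
  "strings_weight p n = run_weight p (replicate n True) +
     (\<Sum>k<n. run_weight p (replicate k True) * strings_weight p (n - Suc k))"
proof -
  let ?f = "\<lambda>k v. replicate k True @ False # v"
  let ?B = "\<lambda>k. ?f k ` {v. length v = n - Suc k}"
  have notin: "replicate n True \<notin> (\<Union>k<n. ?B k)"
  proof
    assume "replicate n True \<in> (\<Union>k<n. ?B k)"
    then have "False \<in> set (replicate n True)" by fastforce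
    then show False by simp
  qed
  have "(\<Sum>s\<in>(\<Union>k<n. ?B k). run_weight p s) = (\<Sum>k<n. \<Sum>s\<in>?B k. run_weight p s)"
    by (intro sum.UNION_disjoint) (auto simp: finite_strings dest: first_zero_unique)
  also have "\<dots> = (\<Sum>k<n. run_weight p (replicate k True) * strings_weight p (n - Suc k))"
    by (intro sum.cong)
       (simp_all add: strings_weight_def sum.reindex inj_on_def run_weight_append_zero
          sum_distrib_left)
  finally show ?thesis
    using notin unfolding strings_weight_def[of p n] strings_first_zero[of n]
    by (subst sum.insert) (auto simp: finite_strings)
qed

section \<open>Generating functions\<close>

definition ones_gf :: "nat \<Rightarrow> int poly fps" where
  "ones_gf p = Abs_fps (\<lambda>k. run_weight p (replicate k True))"

text \<open>
  The coefficient of \<open>x\<^sup>n\<close> belongs to strings of length \<open>n\<close> that end in a zero, that is, to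
  arbitrary strings of length \<open>n - 1\<close>; the empty sequence of blocks gives the constant term.
\<close>

definition shifted_gf :: "nat \<Rightarrow> int poly fps" where
  "shifted_gf p = 1 + fps_X * Abs_fps (strings_weight p)"

lemma shifted_gf_nth:
  "fps_nth (shifted_gf p) n = (if n = 0 then 1 else strings_weight p (n - 1))"
  by (simp add: shifted_gf_def)

text \<open>Split off the first block \<open>1\<^sup>k 0\<close>.\<close>

lemma shifted_gf_eq: "shifted_gf p = 1 + fps_X * (ones_gf p * shifted_gf p)"
proof (rule fps_ext)
  fix n
  show "fps_nth (shifted_gf p) n = fps_nth (1 + fps_X * (ones_gf p * shifted_gf p)) n"
  proof (cases n)
    case 0
    then show ?thesis by (simp add: shifted_gf_nth)
  next
    case (Suc m)
    have "fps_nth (ones_gf p * shifted_gf p) m =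
        (\<Sum>k\<le>m. run_weight p (replicate k True) * fps_nth (shifted_gf p) (m - k))"
      by (simp add: fps_mult_nth ones_gf_def atLeast0AtMost)
    also have "\<dots> = run_weight p (replicate m True) +
        (\<Sum>k<m. run_weight p (replicate k True) * strings_weight p (m - Suc k))"
      by (simp add: lessThan_Suc_atMost[symmetric] shifted_gf_nth)
    finally show ?thesis
      using Suc by (simp add: shifted_gf_nth strings_weight_rec[of p m])
  qed
qed

lemma ones_gf_times:
  fixes p :: nat
  defines "t \<equiv> \<lambda>k. fps_const (run_weight p (replicate k True))"
  shows "(1 - fps_X ^ 2) * ones_gf p = 1 + t 1 * fps_X + (t 2 - 1) * fps_X ^ 2"
proof (rule fps_ext)
  fix n
  have 0: "run_weight p [] = 1"
    using run_weight_replicate_True[of p 0] by simp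
  have per: "run_weight p (replicate n True) = run_weight p (replicate (n - 2) True)"
    if "n > 2"
  proof -
    have "n mod 2 = (n - 2) mod 2"
      using that by (simp add: le_mod_geq)
    then show ?thesis
      using that by (simp only: run_weight_replicate_True cong_def) simp
  qed
  consider "n = 0" | "n = 1" | "n = 2" | "n > 2" by linarith
  then show "fps_nth ((1 - fps_X ^ 2) * ones_gf p) n =
      fps_nth (1 + t 1 * fps_X + (t 2 - 1) * fps_X ^ 2) n"
    by cases (auto simp: t_def algebra_simps fps_X_power_mult_nth fps_X_power_mult_right_nth
      ones_gf_def 0 per numeral_2_eq_2)
qed

lemma shifted_gf_times_denominator:
  fixes p :: nat
  defines "y \<equiv> fps_const (monom 1 1)"
  assumes "p \<in> {0, 1}"
  shows "shifted_gf p * (1 - fps_X - fps_X^2 * (1 + y ^ of_bool (p = 1))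
           + fps_X^3 * (1 - y ^ of_bool (p = 0))) = 1 - fps_X^2"
    (is "_ * ?E = _")
proof -
  define t where "t = (\<lambda>k. fps_const (run_weight p (replicate k True)))"
  have "t 1 = y ^ of_bool (p = 1)" "t 2 = y ^ of_bool (p = 0)"
    using assms by (auto simp: t_def run_weight_replicate_True cong_def y_def simp del: replicate.simps)
  then have "?E = (1 - fps_X ^ 2) - fps_X * (1 + t 1 * fps_X + (t 2 - 1) * fps_X ^ 2)"
    by (simp add: algebra_simps power2_eq_square power3_eq_cube)
  also have "\<dots> = (1 - fps_X ^ 2) - fps_X * ((1 - fps_X ^ 2) * ones_gf p)"
    by (simp only: ones_gf_times t_def)
  finally have "shifted_gf p * ?E =
      shifted_gf p * ((1 - fps_X ^ 2) - fps_X * ((1 - fps_X ^ 2) * ones_gf p))"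
    by (rule arg_cong)
  also have "\<dots> = (1 - fps_X ^ 2) * (shifted_gf p - fps_X * (ones_gf p * shifted_gf p))"
    by (simp add: algebra_simps)
  also have "shifted_gf p - fps_X * (ones_gf p * shifted_gf p) = 1"
    using shifted_gf_eq[of p] by (simp add: algebra_simps)
  finally show ?thesis by simp
qed

lemma formal_sum_w_times_X:
  "formal_sum (\<lambda>n m. int (w p n m)) * fls_X = fps_to_fls (shifted_gf p)"
proof (rule fls_eqI)
  fix n :: int
  have "poly.coeff (fls_nth (formal_sum (\<lambda>n m. int (w p n m))) (n - 1)) k =
      poly.coeff (fls_nth (fps_to_fls (shifted_gf p)) n) k" for k
  proof -
    consider "n < 0" | "n = 0" | "n > 0" by linarith
    then show ?thesis
    proof cases
      case 3
      then have "int (nat n - 1) = n - 1" by simp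
      with 3 show ?thesis
        by (simp add: coeff_formal_sum_w shifted_gf_nth coeff_strings_weight)
    next
      case 2
      then show ?thesis
        unfolding coeff_formal_sum_w by (simp add: shifted_gf_nth w_def)
    next
      case 1
      then show ?thesis
        unfolding coeff_formal_sum_w by (simp add: w_def)
    qed
  qed
  then show "fls_nth (formal_sum (\<lambda>n m. int (w p n m)) * fls_X) n =
      fls_nth (fps_to_fls (shifted_gf p)) n"
    by (simp add: poly_eq_iff fls_X_times_conv_shift)
qed

theorem mainTheorem8:
  fixes p :: nat
  assumes "p \<in> {0, 1}"
  shows "formal_sum (\<lambda>n m. int (w p n m)) =
    fls_quotient (1 - fls_X^2)
      (fls_X * (1 - fls_X - fls_X^2 * (1 + fls_Y ^ of_bool (p = 1))
                + fls_X^3 * (1 - fls_Y ^ of_bool (p = 0))))"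
proof -
  define y :: "int poly fps" where "y = fps_const (monom 1 1)"
  have y: "fls_Y = fps_to_fls y"
    by (simp only: y_def fps_const_to_fls)
  have "fps_to_fls (shifted_gf p) * (1 - fls_X - fls_X^2 * (1 + fls_Y ^ of_bool (p = 1))
      + fls_X^3 * (1 - fls_Y ^ of_bool (p = 0))) = 1 - fls_X^2"
    using arg_cong[OF shifted_gf_times_denominator[OF assms, folded y_def], of fps_to_fls]
    unfolding y by (simp add: fls_times_fps_to_fls fps_to_fls_power)
  then show ?thesis
    unfolding fls_quotient_iff[OF lowest_coeff_denominator] mult.assoc[symmetric]
      formal_sum_w_times_X .
qed

end
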